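(* There exists an infinite word over a binary alphabet that contains no squares $xx$ with $|x| \geq 3$ in any arithmetic progression of odd difference.
   Context: Infinite words $\mathbf{w} = w_0w_1w_2\cdots$ are indexed from $0$. An arithmetic subsequence of difference $j$ of $\mathbf{w}$ is a word $w_iw_{i+j}w_{i+2j}\cdots$ with $i \geq 0$, $j \geq 1$. Containing no square $xx$ with $|x|\ge 3$ in any arithmetic progression of odd difference means that, for every odd $j\ge 1$, no arithmetic subsequence of difference $j$ of the word contains a contiguous block of the form $xx$ with $|x|\ge 3$. *)

theory Defs
  imports "HOL-Library.Omega_Words_Fun"
begin

definition arith_subseq :: "'a word \<Rightarrow> nat \<Rightarrow> nat \<Rightarrow> 'a word" where
  "arith_subseq w i j = (\<lambda>n. w (i + n * j))"

definition factor :: "'a list \<Rightarrow> 'a word \<Rightarrow> bool" where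
  "factor u v \<longleftrightarrow> (\<exists>k. u = v [k \<rightarrow> k + length u])"

end

theory Submission
  imports Defs "HOL-Number_Theory.Cong"
begin

text \<open>
  Write \<open>\<nu>\<close> for the 2-adic valuation. The letter of the word at \<open>n\<close> depends on \<open>n\<close> modulo 16,
  except that at the multiples of 8 the word is filled with a paperfolding word. Such a word can
  be handled in all progressions of odd difference \<open>j\<close> at once, because \<open>n \<mapsto> i + n * j\<close> permutes
  the residues modulo every power of two: any \<open>2 ^ k\<close> consecutive terms of the progression visit
  each residue class modulo \<open>2 ^ k\<close>.

  A square \<open>xx\<close> with \<open>|x| = m\<close> identifies letters of the word at distance \<open>m * j\<close>, and
  \<open>\<nu> (m * j) = \<nu> m\<close>. One letter of the square is found that differs from its
  counterpart in the other copy of \<open>x\<close>; its residue class depends on \<open>\<nu> m\<close>.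
  If \<open>\<nu> m = e \<ge> 4\<close>, the paperfolding word changes from a position of valuation \<open>e - 1\<close>
  to its counterpart. If \<open>\<nu> m = 3\<close>, the classes 2 and 10 modulo 16 are exchanged, and
  they carry different letters; if \<open>\<nu> m = 2\<close>, the same holds for 3 and 7 modulo 8. If \<open>\<nu> m = 1\<close>, then 7 is
  the only odd class modulo 8 with letter \<open>True\<close>, and it is shifted to another odd class.

  If \<open>m\<close> is odd, the two copies of \<open>x\<close> match even positions with odd ones. The positions congruent
  to 4 and 6 modulo 8 carry \<open>True\<close>, so both would have to be matched with the class 7. This forces
  \<open>m * j\<close> to be both \<open>\<plusminus>3\<close> and \<open>\<plusminus>1\<close> modulo 8, a contradiction as soon as the square has at least
  8 letters. For \<open>m = 3\<close> it has only 6, and a finite inspection modulo 8 remains.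
\<close>

section \<open>The word\<close>

text \<open>
  The regular paperfolding sequence: the letter at \<open>n > 0\<close> depends on the odd part of \<open>n\<close> modulo 4.
  The value at 0 is arbitrary; the arguments below look only at positions that have an odd part.
\<close>

fun paperfold :: "nat \<Rightarrow> bool" where
  "paperfold n = (if n = 0 then False else if odd n then n mod 4 = 3 else paperfold (n div 2))"

declare paperfold.simps [simp del]

lemma paperfold_odd: "odd n \<Longrightarrow> paperfold n \<longleftrightarrow> n mod 4 = 3"
  by (subst paperfold.simps) auto

lemma paperfold_double: "paperfold (2 * n) = paperfold n"
  by (cases "n = 0") (simp, subst paperfold.simps, simp)

lemma paperfold_power2_times: "paperfold (2 ^ k * n) = paperfold n"
  by (induction k) (simp_all add: mult.assoc paperfold_double)

text \<open>
  Class 7 is the only odd class modulo 8 with letter \<open>True\<close>, so a \<open>True\<close> at an even position has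
  just one possible partner at odd distance. Two classes of even positions, 4 and 6, are
  constantly \<open>True\<close> in order to exploit this. Class 2 modulo 8 is split by the single
  exception 2 modulo 16, which detects shifts by 8 modulo 16.
\<close>

definition folded_word :: "bool word" where
  "folded_word n = (if odd n then n mod 8 = 7 else if 8 dvd n then paperfold n else n mod 16 \<noteq> 2)"

lemma folded_word_odd: "odd n \<Longrightarrow> folded_word n \<longleftrightarrow> n mod 8 = 7"
  by (simp add: folded_word_def)

lemma folded_word_3_mod_8: "n mod 8 = 3 \<Longrightarrow> \<not> folded_word n"
  by (subst folded_word_odd) presburger+

lemma folded_word_7_mod_8: "n mod 8 = 7 \<Longrightarrow> folded_word n"
  by (subst folded_word_odd) presburger+

lemma folded_word_mult8: "8 dvd n \<Longrightarrow> folded_word n = paperfold n"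
  unfolding folded_word_def by presburger

lemma folded_word_2_mod_16: "n mod 16 = 2 \<Longrightarrow> \<not> folded_word n"
proof -
  assume "n mod 16 = 2"
  then have "even n" "\<not> 8 dvd n" by presburger+
  then show ?thesis using \<open>n mod 16 = 2\<close> by (simp add: folded_word_def)
qed

lemma folded_word_10_mod_16: "n mod 16 = 10 \<Longrightarrow> folded_word n"
proof -
  assume "n mod 16 = 10"
  then have "even n" "\<not> 8 dvd n" by presburger+
  then show ?thesis using \<open>n mod 16 = 10\<close> by (simp add: folded_word_def)
qed

lemma folded_word_4_6_mod_8: "n mod 8 = 4 \<or> n mod 8 = 6 \<Longrightarrow> folded_word n"
proof -
  assume "n mod 8 = 4 \<or> n mod 8 = 6"
  then have "even n" "\<not> 8 dvd n" "n mod 16 \<noteq> 2" by presburger+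
  then show ?thesis by (simp add: folded_word_def)
qed


section \<open>Residues along a progression of odd difference\<close>

lemma progression_meets_residue:
  fixes i j r k :: nat
  assumes "odd j" "r < 2 ^ k"
  obtains n where "n < 2 ^ k" "(i + n * j) mod 2 ^ k = r"
proof -
  have "coprime j (2 ^ k)" using assms(1) by simp
  then obtain t where t: "[j * t = 1] (mod 2 ^ k)"
    using cong_solve_coprime_nat by (metis One_nat_def)
  \<comment> \<open>a natural number congruent to \<open>r - i\<close> modulo \<open>2 ^ k\<close>\<close>
  define d where "d = r + i * (2 ^ k - 1)"
  define n where "n = (t * d) mod 2 ^ k"
  have "[n * j = (j * t) * d] (mod 2 ^ k)"
    unfolding n_def cong_def mod_mult_left_eq by (simp add: ac_simps)
  also have "[(j * t) * d = 1 * d] (mod 2 ^ k)"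
    using t by (rule cong_scalar_right)
  finally have "[i + n * j = i + d] (mod 2 ^ k)"
    by (simp add: cong_add_lcancel_nat)
  also have "i + d = r + i * 2 ^ k"
  proof -
    have "i \<le> i * 2 ^ k" by simp
    moreover have "d = r + (i * 2 ^ k - i)" unfolding d_def by (simp add: diff_mult_distrib2)
    ultimately show ?thesis by linarith
  qed
  also have "[r + i * 2 ^ k = r] (mod 2 ^ k)"
    by (simp add: cong_def)
  finally have "(i + n * j) mod 2 ^ k = r"
    using assms(2) by (simp add: cong_def)
  moreover have "n < 2 ^ k" by (simp add: n_def)
  ultimately show ?thesis using that by blast
qed

lemma odd_mult_mod_double:
  fixes m j d :: nat
  assumes "odd j" "m mod (2 * d) = d"
  shows "(m * j) mod (2 * d) = d"
proof -
  obtain b c where "m = 2 * d * b + d" "j = 2 * c + 1"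
    using assms by (metis mult_div_mod_eq oddE)
  then have "m * j = d + 2 * d * (b * j + c)" by (simp add: algebra_simps)
  moreover have "d mod (2 * d) = d" by (cases "d = 0") simp_all
  ultimately show ?thesis by (simp only: mod_mult_self2)
qed

lemma swap_residues_mod_double:
  fixes p h r d :: nat
  assumes "p mod h = r" "d mod (2 * h) = h" "h > 0"
  shows "(p mod (2 * h) = r \<and> (p + d) mod (2 * h) = r + h) \<or>
    (p mod (2 * h) = r + h \<and> (p + d) mod (2 * h) = r)"
proof -
  have "r < h" using assms by auto
  have "(p + d) mod (2 * h) = (p mod (2 * h) + h) mod (2 * h)"
    using assms(2) by (metis mod_add_eq)
  moreover have "(r + h) mod (2 * h) = r + h" using \<open>r < h\<close> by simp
  moreover have "(r + h + h) mod (2 * h) = r"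
    using \<open>r < h\<close> by (simp add: add.assoc flip: mult_2)
  moreover have "p mod (2 * h) = r \<or> p mod (2 * h) = r + h"
    using mod_double_nat[of p h] assms(1) by auto
  ultimately show ?thesis by auto
qed

text \<open>
  The counterpart of a letter in the other copy of \<open>x\<close> lies at distance \<open>d = m * j\<close>, before or
  after it. Using both halves makes \<open>2 * m\<close> positions available instead of \<open>m\<close>, which is what
  makes short squares tractable.
\<close>

lemma square_counterpart:
  fixes w :: "'a word" and i j m n :: nat
  assumes "\<And>n. n < m \<Longrightarrow> w (i + n * j) = w (i + (n + m) * j)" and "n < 2 * m"
  obtains q where "w q = w (i + n * j)" "q = i + n * j + m * j \<or> i + n * j = q + m * j"
proof (cases "n < m")
  case True
  then show ?thesis
    using assms(1)[of n] that[of "i + (n + m) * j"] by (simp add: algebra_simps)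
next
  case False
  then obtain l where l: "n = l + m" by (metis le_Suc_ex add.commute not_less)
  then have "l < m" using assms(2) by simp
  then show ?thesis
    using assms(1)[of l] that[of "i + l * j"] l by (simp add: algebra_simps)
qed


section \<open>Absence of squares\<close>

lemma no_square_valuation_ge_4:
  assumes "odd j" "odd a" "e \<ge> 4" and m: "m = 2 ^ e * a"
    and sq: "\<And>n. n < m \<Longrightarrow> folded_word (i + n * j) = folded_word (i + (n + m) * j)"
  shows False
proof -
  obtain k where k: "e = Suc k" "k \<ge> 3" using \<open>e \<ge> 4\<close> by (cases e) auto
  obtain n where n: "n < 2 ^ e" "(i + n * j) mod 2 ^ e = 2 ^ k"
    using progression_meets_residue[OF \<open>odd j\<close>, of "2 ^ k" e i] k by auto
  have "a \<ge> 1" using \<open>odd a\<close> by (cases a) auto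
  then have "n < m" using n(1) m by (metis less_le_trans mult.right_neutral mult_le_mono2)
  obtain b where "i + n * j = 2 ^ e * b + 2 ^ k"
    using n(2) by (metis mult_div_mod_eq)
  then have p: "i + n * j = 2 ^ k * (2 * b + 1)"
    by (simp add: k algebra_simps)
  then have p': "i + (n + m) * j = 2 ^ k * (2 * b + 1 + 2 * (a * j))"
    by (simp add: m k algebra_simps)
  have dvd: "8 dvd 2 ^ k * c" for c :: nat
    using le_imp_power_dvd[OF k(2), of "2::nat"] by (simp add: dvd_mult2)
  have "odd (a * j)" using \<open>odd a\<close> \<open>odd j\<close> by simp
  \<comment> \<open>Both positions have valuation \<open>k\<close>, and their odd parts differ by 2 modulo 4.\<close>
  then have "(2 * b + 1 + 2 * (a * j)) mod 4 = 3 \<longleftrightarrow> (2 * b + 1) mod 4 \<noteq> 3"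
    by presburger
  then show False
    using sq[OF \<open>n < m\<close>]
    unfolding p p' folded_word_mult8[OF dvd] paperfold_power2_times
    by (simp add: paperfold_odd)
qed

lemma no_square_valuation_3:
  assumes "odd j" and m: "m mod 16 = 8"
    and sq: "\<And>n. n < m \<Longrightarrow> folded_word (i + n * j) = folded_word (i + (n + m) * j)"
  shows False
proof -
  obtain n where n: "n < 8" "(i + n * j) mod 8 = 2"
    using progression_meets_residue[OF \<open>odd j\<close>, of 2 3 i] by auto
  have "m \<ge> 8" using m by presburger
  then have nm: "n < m" using n(1) by simp
  have "(m * j) mod 16 = 8" using odd_mult_mod_double[OF \<open>odd j\<close>, of m 8] m by simp
  moreover have "folded_word (i + n * j) = folded_word (i + n * j + m * j)"
    using sq[OF nm] by (simp add: algebra_simps)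
  ultimately show False
    using swap_residues_mod_double[of "i + n * j" 8 2 "m * j"] n(2)
    by (auto simp: folded_word_2_mod_16 folded_word_10_mod_16)
qed

lemma no_square_valuation_2:
  assumes "odd j" and m: "m mod 8 = 4"
    and sq: "\<And>n. n < m \<Longrightarrow> folded_word (i + n * j) = folded_word (i + (n + m) * j)"
  shows False
proof -
  obtain n where n: "n < 4" "(i + n * j) mod 4 = 3"
    using progression_meets_residue[OF \<open>odd j\<close>, of 3 2 i] by auto
  have "m \<ge> 4" using m by presburger
  then have nm: "n < m" using n(1) by simp
  have "(m * j) mod 8 = 4" using odd_mult_mod_double[OF \<open>odd j\<close>, of m 4] m by simp
  moreover have "folded_word (i + n * j) = folded_word (i + n * j + m * j)"
    using sq[OF nm] by (simp add: algebra_simps)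
  ultimately show False
    using swap_residues_mod_double[of "i + n * j" 4 3 "m * j"] n(2)
    by (auto simp: folded_word_3_mod_8 folded_word_7_mod_8)
qed

lemma no_square_valuation_1:
  assumes "odd j" and m: "m mod 4 = 2" "m \<ge> 3"
    and sq: "\<And>n. n < m \<Longrightarrow> folded_word (i + n * j) = folded_word (i + (n + m) * j)"
  shows False
proof -
  obtain n where n: "n < 8" "(i + n * j) mod 8 = 7"
    using progression_meets_residue[OF \<open>odd j\<close>, of 7 3 i] by auto
  \<comment> \<open>Here \<open>m \<ge> 6\<close>, so the square has at least 12 letters.\<close>
  have "n < 2 * m" using m n(1) by presburger
  then obtain q where q: "folded_word q = folded_word (i + n * j)"
      "q = i + n * j + m * j \<or> i + n * j = q + m * j"
    using square_counterpart[of m folded_word i j n] sq by blast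
  have "(m * j) mod 4 = 2" using odd_mult_mod_double[OF \<open>odd j\<close>, of m 2] m by simp
  then have d: "even (m * j)" "\<not> [m * j = 0] (mod 8)"
    unfolding cong_def by presburger+
  have "odd (i + n * j)" using n(2) by presburger
  then have "odd q" using q(2) d(1) by (metis even_add)
  have "folded_word q" using q(1) n(2) folded_word_7_mod_8 by blast
  then have "[q = i + n * j] (mod 8)"
    using \<open>odd q\<close> n(2) by (simp add: folded_word_odd cong_def)
  then show False
    using q(2) d(2) cong_add_lcancel_0_nat cong_sym by metis
qed

lemma counterpart_of_4_6_is_7:
  assumes "folded_word q = folded_word p" "p mod 8 = 4 \<or> p mod 8 = 6" "odd d"
    and "q = p + d \<or> p = q + d"
  shows "q mod 8 = 7"
proof -
  have "even p" using assms(2) by presburger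
  then have "odd q" using assms(3,4) by (metis even_add)
  then show ?thesis using assms(1,2) folded_word_4_6_mod_8 folded_word_odd by metis
qed

text \<open>
  A square of period 3 has six letters and need not meet both classes 4 and 6. If it meets 4 but
  not 6, then 4 can only be matched with 7, so \<open>j\<close> is \<open>\<plusminus>1\<close>; up to reversal the classes are then
  7, 0, 1, 2, 3, 4, where 4 is matched with 1. If it meets 6 but not 4, then likewise \<open>j\<close> is
  \<open>\<plusminus>3\<close>, and in 7, 2, 5, 0, 3, 6 the class 6 is matched with 5. In the finite statement, \<open>a\<close> and
  \<open>b\<close> are the residues of \<open>i\<close> and \<open>j\<close>.
\<close>

lemma period_3_mismatch_mod_8:
  "\<forall>a\<in>{0,1,2,3,4,5,6,7::nat}. \<forall>b\<in>{1,3,5,7::nat}. \<exists>n\<in>{0,1,2::nat}.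
     (((a + n * b) mod 8 = 4 \<or> (a + n * b) mod 8 = 6) \<and> (a + (n + 3) * b) mod 8 \<noteq> 7) \<or>
     (((a + (n + 3) * b) mod 8 = 4 \<or> (a + (n + 3) * b) mod 8 = 6) \<and> (a + n * b) mod 8 \<noteq> 7)"
  by (simp only: ball_simps bex_simps) simp

lemma no_square_period_3:
  assumes "odd j"
    and sq: "\<And>n. n < 3 \<Longrightarrow> folded_word (i + n * j) = folded_word (i + (n + 3) * j)"
  shows False
proof -
  have residues: "i mod 8 \<in> {0,1,2,3,4,5,6,7}" "j mod 8 \<in> {1,3,5,7}"
    using \<open>odd j\<close> by (simp_all, presburger+)
  have reduce: "(i mod 8 + c * (j mod 8)) mod 8 = (i + c * j) mod 8" for c
    by (intro mod_add_cong) (simp_all add: mod_mult_right_eq)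
  obtain n where n: "n \<in> {0,1,2}"
    "(((i + n * j) mod 8 = 4 \<or> (i + n * j) mod 8 = 6) \<and> (i + (n + 3) * j) mod 8 \<noteq> 7) \<or>
     (((i + (n + 3) * j) mod 8 = 4 \<or> (i + (n + 3) * j) mod 8 = 6) \<and> (i + n * j) mod 8 \<noteq> 7)"
    using bspec[OF bspec[OF period_3_mismatch_mod_8 residues(1)] residues(2)]
    unfolding reduce by blast
  have "odd (3 * j)" using \<open>odd j\<close> by simp
  moreover have "i + (n + 3) * j = i + n * j + 3 * j" by (simp add: algebra_simps)
  moreover have "n < 3" using n(1) by auto
  ultimately show False
    using n(2) sq[of n] counterpart_of_4_6_is_7[of "i + (n + 3) * j" "i + n * j" "3 * j"]
      counterpart_of_4_6_is_7[of "i + n * j" "i + (n + 3) * j" "3 * j"]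
    by argo
qed

lemma no_square_odd_period:
  assumes "odd j" "odd m" "m \<ge> 3"
    and sq: "\<And>n. n < m \<Longrightarrow> folded_word (i + n * j) = folded_word (i + (n + m) * j)"
  shows False
proof (cases "m = 3")
  case True
  show False using no_square_period_3[OF \<open>odd j\<close> sq[unfolded True]] .
next
  case False
  then have "8 < 2 * m" using \<open>odd m\<close> \<open>m \<ge> 3\<close> by presburger
  have odd: "odd (m * j)" using \<open>odd j\<close> \<open>odd m\<close> by simp
  have *: "\<exists>p q. p mod 8 = r \<and> q mod 8 = 7 \<and> (q = p + m * j \<or> p = q + m * j)"
    if r: "r = 4 \<or> r = 6" for r :: nat
  proof -
    have "r < 2 ^ 3" using r by auto
    then obtain n where "n < 2 ^ 3" "(i + n * j) mod 2 ^ 3 = r"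
      using progression_meets_residue[OF \<open>odd j\<close>] by blast
    then have n: "n < 8" "(i + n * j) mod 8 = r" by simp_all
    then have "n < 2 * m" using \<open>8 < 2 * m\<close> by simp
    then obtain q where q: "folded_word q = folded_word (i + n * j)"
        "q = i + n * j + m * j \<or> i + n * j = q + m * j"
      using square_counterpart[of m folded_word i j n] sq by blast
    then have "q mod 8 = 7" using counterpart_of_4_6_is_7 odd n(2) r by blast
    then show ?thesis using n(2) q(2) by blast
  qed
  have **: "(r + m * j) mod 8 = 7 \<or> (7 + m * j) mod 8 = r" if "r = 4 \<or> r = 6" for r
    using *[OF that] by (metis mod_add_left_eq)
  show False using **[of 4] **[of 6] by presburger
qed

lemma folded_word_no_square:
  assumes "odd j" "m \<ge> 3"
    and sq: "\<And>n. n < m \<Longrightarrow> folded_word (i + n * j) = folded_word (i + (n + m) * j)"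
  shows False
proof -
  have "m \<noteq> 0" using \<open>m \<ge> 3\<close> by simp
  then obtain e a where ea: "odd a" "m = 2 ^ e * a"
    by (metis multiplicity_decompose' odd_one)
  consider "e = 0" | "e = 1" | "e = 2" | "e = 3" | "e \<ge> 4" by linarith
  then show False
  proof cases
    case 1
    then show False using no_square_odd_period[OF assms(1) _ assms(2) sq] ea by simp
  next
    case 2
    then have "m mod 4 = 2" using ea by simp presburger
    then show False using no_square_valuation_1[OF assms(1) _ assms(2) sq] by blast
  next
    case 3
    then have "m mod 8 = 4" using ea by simp presburger
    then show False using no_square_valuation_2[OF assms(1) _ sq] by blast
  next
    case 4
    then have "m mod 16 = 8" using ea by simp presburger
    then show False using no_square_valuation_3[OF assms(1) _ sq] by blast
  next
    case 5
    then show False using no_square_valuation_ge_4[OF assms(1) ea(1) _ ea(2) sq] by blast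
  qed
qed

lemma factor_square_imp_periodic:
  assumes "factor (x @ x) (arith_subseq w i j)"
  obtains k where "\<And>n. n < length x \<Longrightarrow>
    w (i + k * j + n * j) = w (i + k * j + (n + length x) * j)"
proof -
  from assms obtain k where
    k: "x @ x = arith_subseq w i j [k \<rightarrow> k + length (x @ x)]"
    unfolding factor_def by blast
  have letter: "(x @ x) ! n = w (i + k * j + n * j)" if "n < 2 * length x" for n
    using that by (subst k) (simp add: arith_subseq_def algebra_simps)
  have "w (i + k * j + n * j) = w (i + k * j + (n + length x) * j)" if "n < length x" for n
    using that letter[of n] letter[of "n + length x"] by (simp add: nth_append)
  then show ?thesis using that by blast
qed

theorem theorem15:
  shows "\<exists>w :: bool word. \<forall>i j. j \<ge> 1 \<longrightarrow> odd j \<longrightarrow>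
           \<not> (\<exists>x. length x \<ge> 3 \<and> factor (x @ x) (arith_subseq w i j))"
proof (intro exI[of _ folded_word] allI impI notI)
  fix i j :: nat
  assume "odd j" and "\<exists>x. length x \<ge> 3 \<and> factor (x @ x) (arith_subseq folded_word i j)"
  then obtain x where x: "length x \<ge> 3" "factor (x @ x) (arith_subseq folded_word i j)"
    by blast
  then obtain k where "\<And>n. n < length x \<Longrightarrow>
      folded_word (i + k * j + n * j) = folded_word (i + k * j + (n + length x) * j)"
    using factor_square_imp_periodic by metis
  then show False using folded_word_no_square[OF \<open>odd j\<close> x(1)] by blast
qed

end
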